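(* Let $\bar{a}(N)$ denote the number of partitions $\lambda$ of $N$ with at least two parts, no parts of size $1$, and $\lambda_1=\lambda_2$. For every integer $j\ge 4$, $$PM(3j,j)-PM(3j-2,j-1)=\bar{a}(2j+1)+1.$$
   Context: A partition $\lambda=(\lambda_1\ge\cdots\ge\lambda_\ell)$ of $n$ is a finite nonincreasing sequence of positive integers with sum $n$; $\ell(\lambda)$ is its number of parts. The hook length $h_{(i,j)}(\lambda)$ of a cell $(i,j)$ of the Ferrers diagram is the number of cells consisting of the cell itself, the cells to its right in its row and the cells below it in its column. A numerical set is a subset $S\subseteq\mathbb{N}_0$ containing $0$ with finite complement; a numerical semigroup is a numerical set closed under addition. For a partition $\lambda$ let $S_\lambda=\mathbb{N}_0\setminus\{h_{(i,1)}(\lambda):1\le i\le\ell(\lambda)\}$. $PM(n,m)$ is the number of partitions $\lambda$ of $n$ having exactly $m-1$ parts equal to $1$ such that $S_\lambda$ is a numerical semigroup. *)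

theory Defs
  imports Main
begin

definition is_partition :: "nat list \<Rightarrow> nat \<Rightarrow> bool" where
  "is_partition l n \<longleftrightarrow> sorted_wrt (\<ge>) l \<and> (\<forall>x\<in>set l. x > 0) \<and> sum_list l = n"

(* Cells are indexed from 1, list positions from 0: the part \<lambda>_i is l ! (i - 1). *)
definition ferrers :: "nat list \<Rightarrow> (nat \<times> nat) set" where
  "ferrers l = {(i, j). 1 \<le> i \<and> i \<le> length l \<and> 1 \<le> j \<and> j \<le> l ! (i - 1)}"

(* Only meaningful for cells (i, j) of the diagram. *)
definition hook_length :: "nat list \<Rightarrow> nat \<Rightarrow> nat \<Rightarrow> nat" where
  "hook_length l i j =
     card {(i', j'). (i', j') \<in> ferrers l \<and> (i' = i \<and> j' \<ge> j \<or> j' = j \<and> i' \<ge> i)}"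

definition numerical_set :: "nat set \<Rightarrow> bool" where
  "numerical_set S \<longleftrightarrow> 0 \<in> S \<and> finite (- S)"

definition numerical_semigroup :: "nat set \<Rightarrow> bool" where
  "numerical_semigroup S \<longleftrightarrow> numerical_set S \<and> (\<forall>a\<in>S. \<forall>b\<in>S. a + b \<in> S)"

definition S_of :: "nat list \<Rightarrow> nat set" where
  "S_of l = UNIV - {hook_length l i 1 | i. 1 \<le> i \<and> i \<le> length l}"

(* "Exactly m - 1 parts equal to 1" is written without truncated subtraction. *)
definition PM :: "nat \<Rightarrow> nat \<Rightarrow> nat" where
  "PM n m = card {l. is_partition l n \<and> count_list l 1 + 1 = m \<and> numerical_semigroup (S_of l)}"

definition a_bar :: "nat \<Rightarrow> nat" where
  "a_bar N = card {l. is_partition l N \<and> length l \<ge> 2 \<and> 1 \<notin> set l \<and> l ! 0 = l ! 1}"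

(* The cardinalities in PM and a_bar are therefore taken over finite sets. *)
lemma finite_partitions: "finite {l. is_partition l n}"
proof (rule finite_subset)
  have "length l \<le> sum_list l" if "\<forall>x\<in>set l. x > 0" for l :: "nat list"
    using that by (induction l) auto
  then show "{l. is_partition l n} \<subseteq> {l. set l \<subseteq> {..n} \<and> length l \<le> n}"
    using member_le_sum_list by (auto simp: is_partition_def)
  show "finite {l. set l \<subseteq> {..n} \<and> length l \<le> n}"
    by (rule finite_lists_length_le) simp
qed

end

theory Submission
  imports Defs
begin

text \<open>
  Deleting the \<open>m - 1\<close> ones from a partition leaves a partition \<open>\<mu>\<close> into parts \<open>\<ge> 2\<close>, of \<open>2 j + 1\<close>
  for \<open>PM (3 j) j\<close> and of \<open>2 j\<close> for \<open>PM (3 j - 2) (j - 1)\<close>. The gaps are then \<open>1, \<dots>, m - 1\<close> and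
  \<open>m + t\<close> for \<open>t\<close> in a set \<open>T\<close> of positive numbers, and the semigroup condition says that
  \<open>m + u + v \<notin> T\<close> for all \<open>u, v \<notin> T\<close>. A size estimate shows that, with few exceptions, only the largest
  element of \<open>T\<close> can be \<open>\<ge> m\<close>. Raising the largest part and \<open>m\<close> by one moves this element and
  \<open>m\<close> in parallel, so it preserves the condition; its image is the set of \<open>\<mu>\<close> with
  \<open>\<mu>\<^sub>1 > \<mu>\<^sub>2\<close>. The exceptions are the \<open>j - 2\<close> partitions \<open>(a, a, 2, \<dots>, 2)\<close> of \<open>2 j\<close>, which satisfy
  the condition only after the raise. The \<open>\<mu>\<close> with \<open>\<mu>\<^sub>1 = \<mu>\<^sub>2\<close> all satisfy the condition, except for the
  \<open>j - 3\<close> partitions \<open>(a, a, 3, 2, \<dots>, 2)\<close> of \<open>2 j + 1\<close>.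
\<close>

section \<open>First-column hook lengths\<close>

text \<open>For positive parts these are the beta-numbers of the partition: a part counts the hook
  cells in its own row, and the number of later rows counts the cells below.\<close>

fun column_hooks :: "nat list \<Rightarrow> nat set" where
  "column_hooks [] = {}"
| "column_hooks (x # xs) = insert (x + length xs) (column_hooks xs)"

lemma column_hooks_conv_nth:
  "column_hooks l = (\<lambda>i. l ! i + (length l - Suc i)) ` {..<length l}"
proof (induction l)
  case (Cons x xs)
  then show ?case by (simp add: lessThan_Suc_eq_insert_0 image_image)
qed simp

text \<open>Every part is positive, so each lower row meets the first column and the leg has
  \<open>length l - i\<close> cells.\<close>

lemma hook_length_first_column:
  assumes "\<forall>x\<in>set l. x > 0" "1 \<le> i" "i \<le> length l"
  shows "hook_length l i 1 = l ! (i - 1) + (length l - i)"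
proof -
  have pos: "1 \<le> l ! (k - 1)" if "1 \<le> k" "k \<le> length l" for k
    using assms(1) that by (simp add: Suc_leI)
  have "{(i', j'). (i', j') \<in> ferrers l \<and> (i' = i \<and> j' \<ge> 1 \<or> j' = 1 \<and> i' \<ge> i)}
     = {i} \<times> {1..l ! (i - 1)} \<union> {i<..length l} \<times> {1}"
    (is "?L = ?R")
  proof (rule set_eqI)
    fix c :: "nat \<times> nat"
    obtain a b where c: "c = (a, b)" by fastforce
    show "c \<in> ?L \<longleftrightarrow> c \<in> ?R"
      using assms(2,3) pos[of a] unfolding c by (cases "a = i") (auto simp: ferrers_def)
  qed
  moreover have "card ({i} \<times> {1..l ! (i - 1)} \<union> {i<..length l} \<times> {1}) = l ! (i - 1) + (length l - i)"
    by (subst card_Un_disjoint) (auto simp: card_cartesian_product)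
  ultimately show ?thesis by (simp add: hook_length_def)
qed

lemma S_of_eq_Compl_column_hooks:
  assumes "\<forall>x\<in>set l. x > 0"
  shows "S_of l = - column_hooks l"
proof -
  have "{hook_length l i 1 | i. 1 \<le> i \<and> i \<le> length l} = column_hooks l"
  proof -
    have "{i. 1 \<le> i \<and> i \<le> length l} = Suc ` {..<length l}"
      by (auto simp: image_iff Suc_le_eq gr0_conv_Suc)
    moreover have "{hook_length l i 1 | i. 1 \<le> i \<and> i \<le> length l}
      = (\<lambda>i. hook_length l i 1) ` {i. 1 \<le> i \<and> i \<le> length l}" by blast
    moreover have "(\<lambda>i. hook_length l (Suc i) 1) ` {..<length l} = column_hooks l"
      unfolding column_hooks_conv_nth
      by (rule image_cong[OF refl]) (subst hook_length_first_column[OF assms]; simp)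
    ultimately show ?thesis by (simp add: image_image)
  qed
  then show ?thesis by (simp add: S_of_def Compl_eq_Diff_UNIV)
qed

lemma column_hooks_replicate_1: "column_hooks (replicate p 1) = {1..p}"
  by (induction p) auto

text \<open>The new rows have hooks \<open>1, ..., p\<close> themselves and lengthen every older
  first-column hook by \<open>p\<close>.\<close>

lemma column_hooks_append_ones:
  "column_hooks (\<mu> @ replicate p 1) = {1..p} \<union> (\<lambda>h. h + p) ` column_hooks \<mu>"
  by (induction \<mu>) (auto simp: column_hooks_replicate_1[simplified])

lemma finite_column_hooks: "finite (column_hooks l)"
  by (induction l) auto


section \<open>Partitions without ones\<close>

definition parts_ge2 :: "nat \<Rightarrow> nat list set" where
  "parts_ge2 N = {\<mu>. sorted_wrt (\<ge>) \<mu> \<and> (\<forall>x\<in>set \<mu>. 2 \<le> x) \<and> sum_list \<mu> = N}"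

text \<open>Appending \<open>m - 1\<close> ones turns the hook \<open>Suc t\<close> into
  \<open>m + t\<close>. Recording \<open>t\<close> gives a set that does not depend on
  \<open>m\<close>.\<close>

definition excess :: "nat list \<Rightarrow> nat set" where
  "excess \<mu> = {t. Suc t \<in> column_hooks \<mu>}"

text \<open>Closure for the elements \<open>m + u\<close> and \<open>m + v\<close>, whose sum is
  \<open>m + (u + v + m)\<close>.\<close>

definition admissible :: "nat \<Rightarrow> nat list \<Rightarrow> bool" where
  "admissible m \<mu> \<longleftrightarrow> (\<forall>u v. u \<notin> excess \<mu> \<longrightarrow> v \<notin> excess \<mu> \<longrightarrow> u + v + m \<notin> excess \<mu>)"

lemma excess_Nil [simp]: "excess [] = {}"
  by (simp add: excess_def)

lemma excess_Cons: "0 < x \<Longrightarrow> excess (x # xs) = insert (x + length xs - 1) (excess xs)"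
  by (auto simp: excess_def)

lemma zero_notin_excess: "\<forall>x\<in>set \<mu>. 2 \<le> x \<Longrightarrow> 0 \<notin> excess \<mu>"
  by (induction \<mu>) (auto simp: excess_Cons)

text \<open>First-column hooks decrease down the rows, so the first row has the largest one.\<close>

lemma excess_upper_bound:
  assumes "sorted_wrt (\<ge>) (y # ys)" "\<forall>x\<in>set (y # ys). 2 \<le> x" "t \<in> excess (y # ys)"
  shows "t \<le> y + length ys - 1"
  using assms
proof (induction ys arbitrary: y)
  case (Cons z zs)
  then show ?case
    by (force simp: excess_Cons)
qed (auto simp: excess_Cons)

lemma sorted_wrt_ge_replicate: "sorted_wrt (\<ge>) (replicate p (x :: nat))"
  by (induction p) auto

lemma two_length_le_sum_list:
  "\<forall>x\<in>set \<mu>. 2 \<le> x \<Longrightarrow> 2 * length \<mu> \<le> sum_list (\<mu> :: nat list)"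
  by (induction \<mu>) auto

lemma sum_list_eq_two_length:
  assumes "\<forall>x\<in>set \<mu>. 2 \<le> x" "sum_list \<mu> = 2 * length (\<mu> :: nat list)"
  shows "\<mu> = replicate (length \<mu>) 2"
  using assms
proof (induction \<mu>)
  case (Cons x xs)
  with two_length_le_sum_list[of xs] have "x = 2" "sum_list xs = 2 * length xs" by auto
  with Cons show ?case by simp
qed simp

text \<open>One unit above the minimal sum must sit on a single part, and the order makes that part
  the first.\<close>

lemma sum_list_eq_two_length_Suc:
  assumes "\<forall>x\<in>set \<mu>. 2 \<le> x" "sorted_wrt (\<ge>) \<mu>" "sum_list \<mu> = Suc (2 * length (\<mu> :: nat list))"
  shows "\<mu> = 3 # replicate (length \<mu> - 1) 2"
proof (cases \<mu>)
  case (Cons x xs)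
  with assms two_length_le_sum_list[of xs]
  have "x = 3 \<or> x = 2" "x = 3 \<Longrightarrow> sum_list xs = 2 * length xs"
    "x = 2 \<Longrightarrow> sum_list xs = Suc (2 * length xs)" by auto
  moreover have "x \<noteq> 2"
  proof
    assume "x = 2"
    with assms Cons have "\<forall>y\<in>set xs. y = 2" by force
    then have "sum_list xs = 2 * length xs" by (induction xs) auto
    with calculation \<open>x = 2\<close> show False by simp
  qed
  ultimately show ?thesis
    using sum_list_eq_two_length[of xs] assms(1) Cons by auto
qed (use assms in simp)

text \<open>The nonzero elements of the set are the \<open>m + t\<close> with \<open>t\<close>
  outside \<open>excess \<mu>\<close>, and sums involving \<open>0\<close> are trivial.\<close>

lemma numerical_semigroup_append_ones:
  assumes ge2: "\<forall>x\<in>set \<mu>. 2 \<le> x" and "1 \<le> m"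
  shows "numerical_semigroup (S_of (\<mu> @ replicate (m - 1) 1)) \<longleftrightarrow> admissible m \<mu>"
proof -
  let ?S = "S_of (\<mu> @ replicate (m - 1) 1)"
  have "\<forall>x\<in>set (\<mu> @ replicate (m - 1) 1). x > 0"
    using ge2 by auto
  then have S: "?S = - ({1..m - 1} \<union> (\<lambda>h. h + (m - 1)) ` column_hooks \<mu>)"
    by (simp only: S_of_eq_Compl_column_hooks column_hooks_append_ones)
  \<comment> \<open>Hooks are positive, so each has the form \<open>Suc t\<close> that
    \<open>excess\<close> records.\<close>
  have hook_pos: "0 \<notin> column_hooks \<nu>" if "\<forall>x\<in>set \<nu>. 2 \<le> x" for \<nu>
    using that by (induction \<nu>) auto
  have "(\<lambda>h. h + (m - 1)) ` column_hooks \<mu> = (\<lambda>t. m + t) ` excess \<mu>"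
  proof (intro equalityI subsetI)
    fix g assume "g \<in> (\<lambda>h. h + (m - 1)) ` column_hooks \<mu>"
    then obtain h where h: "h \<in> column_hooks \<mu>" "g = h + (m - 1)" by blast
    with hook_pos[OF ge2] obtain t where "h = Suc t" by (cases h) auto
    with h \<open>1 \<le> m\<close> show "g \<in> (\<lambda>t. m + t) ` excess \<mu>" by (auto simp: excess_def)
  next
    fix g assume "g \<in> (\<lambda>t. m + t) ` excess \<mu>"
    then obtain t where "Suc t \<in> column_hooks \<mu>" "g = m + t" by (auto simp: excess_def)
    moreover have "m + t = Suc t + (m - 1)" using \<open>1 \<le> m\<close> by simp
    ultimately show "g \<in> (\<lambda>h. h + (m - 1)) ` column_hooks \<mu>" by blast
  qed
  with S have S': "?S = - ({1..m - 1} \<union> (\<lambda>t. m + t) ` excess \<mu>)" by simp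
  have mem: "m + t \<in> ?S \<longleftrightarrow> t \<notin> excess \<mu>" for t
    unfolding S' using \<open>1 \<le> m\<close> by auto
  have small: "\<exists>t. a = m + t" if "a \<in> ?S" "a \<noteq> 0" for a
  proof -
    from that have "m \<le> a" unfolding S' by auto
    then show ?thesis by (simp add: le_iff_add)
  qed
  have "numerical_set ?S"
  proof -
    have "0 \<in> ?S" using \<open>1 \<le> m\<close> unfolding S' by auto
    moreover have "finite (- ?S)" unfolding S using finite_column_hooks by simp
    ultimately show ?thesis by (simp add: numerical_set_def)
  qed
  moreover have "(\<forall>a\<in>?S. \<forall>b\<in>?S. a + b \<in> ?S) \<longleftrightarrow> admissible m \<mu>"
  proof
    assume closed: "\<forall>a\<in>?S. \<forall>b\<in>?S. a + b \<in> ?S"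
    show "admissible m \<mu>" unfolding admissible_def
    proof (intro allI impI)
      fix u v assume "u \<notin> excess \<mu>" "v \<notin> excess \<mu>"
      then have "(m + u) + (m + v) \<in> ?S" using closed mem by blast
      then have "m + (u + v + m) \<in> ?S" by (simp add: ac_simps)
      then show "u + v + m \<notin> excess \<mu>" using mem by blast
    qed
  next
    assume adm: "admissible m \<mu>"
    show "\<forall>a\<in>?S. \<forall>b\<in>?S. a + b \<in> ?S"
    proof (intro ballI)
      fix a b assume ab: "a \<in> ?S" "b \<in> ?S"
      show "a + b \<in> ?S"
      proof (cases "a = 0 \<or> b = 0")
        case False
        then obtain u v where uv: "a = m + u" "b = m + v" using ab small by blast
        then have "u + v + m \<notin> excess \<mu>" using adm ab mem unfolding admissible_def by blast
        then have "m + (u + v + m) \<in> ?S" using mem by blast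
        then show ?thesis using uv by (simp add: ac_simps)
      qed (use ab in auto)
    qed
  qed
  ultimately show ?thesis by (simp add: numerical_semigroup_def)
qed

lemma partition_split_ones:
  assumes "sorted_wrt (\<ge>) l" "\<forall>x\<in>set l. 0 < (x :: nat)"
  shows "filter (\<lambda>x. 2 \<le> x) l @ replicate (count_list l 1) 1 = l"
  using assms
proof (induction l)
  case (Cons x xs)
  show ?case
  proof (cases "2 \<le> x")
    case False
    with Cons.prems have "x = 1" "\<forall>y\<in>set xs. y = 1" by force+
    then have "filter (\<lambda>x. 2 \<le> x) xs = []" by (auto simp: filter_empty_conv)
    with Cons \<open>x = 1\<close> show ?thesis by simp
  qed (use Cons in auto)
qed simp

lemma PM_eq_card_admissible:
  assumes "1 \<le> m"
  shows "PM (N + (m - 1)) m = card {\<mu> \<in> parts_ge2 N. admissible m \<mu>}"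
proof -
  let ?f = "\<lambda>\<mu>. \<mu> @ replicate (m - 1) (1 :: nat)"
  let ?A = "{\<mu> \<in> parts_ge2 N. admissible m \<mu>}"
  let ?B = "{l. is_partition l (N + (m - 1)) \<and> count_list l 1 + 1 = m \<and> numerical_semigroup (S_of l)}"
  have "?f ` ?A = ?B"
  proof (intro equalityI subsetI)
    fix l assume "l \<in> ?f ` ?A"
    then obtain \<mu> where \<mu>: "\<mu> \<in> parts_ge2 N" "admissible m \<mu>" "l = ?f \<mu>" by blast
    then have ge2: "\<forall>x\<in>set \<mu>. 2 \<le> x" by (simp add: parts_ge2_def)
    then have "count_list \<mu> 1 = 0" by (auto simp: count_list_0_iff)
    moreover have "count_list (replicate p (1::nat)) 1 = p" for p by (induction p) auto
    ultimately have "count_list l 1 + 1 = m" using \<mu> assms by simp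
    moreover have "is_partition l (N + (m - 1))"
    proof -
      have "sorted_wrt (\<ge>) l"
        using \<mu> ge2 by (auto simp: parts_ge2_def sorted_wrt_append sorted_wrt_ge_replicate)
      moreover have "\<forall>x\<in>set l. 0 < x" using \<mu>(3) ge2 by auto
      moreover have "sum_list l = N + (m - 1)"
        using \<mu> by (simp add: parts_ge2_def sum_list_replicate)
      ultimately show ?thesis by (simp add: is_partition_def)
    qed
    ultimately show "l \<in> ?B"
      using numerical_semigroup_append_ones[OF ge2 assms] \<mu> by simp
  next
    fix l assume l: "l \<in> ?B"
    define \<mu> where "\<mu> = filter (\<lambda>x. 2 \<le> x) l"
    have "l = ?f \<mu>"
    proof -
      have "m - 1 = count_list l 1" using l by auto
      then show ?thesis
        using partition_split_ones[of l] l by (simp add: \<mu>_def is_partition_def)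
    qed
    moreover have ge2: "\<forall>x\<in>set \<mu>. 2 \<le> x" by (simp add: \<mu>_def)
    moreover have "\<mu> \<in> parts_ge2 N"
    proof -
      have "sum_list (?f \<mu>) = N + (m - 1)" "sorted_wrt (\<ge>) (?f \<mu>)"
        using l \<open>l = ?f \<mu>\<close> unfolding is_partition_def by auto
      then show ?thesis using ge2
        by (simp add: parts_ge2_def sum_list_replicate sorted_wrt_append)
    qed
    moreover have "admissible m \<mu>"
      using numerical_semigroup_append_ones[OF ge2 assms] l \<open>l = ?f \<mu>\<close> by simp
    ultimately show "l \<in> ?f ` ?A" by blast
  qed
  moreover have "inj_on ?f ?A" by (auto simp: inj_on_def)
  ultimately have "card ?B = card ?A" using card_image[of ?f ?A] by simp
  then show ?thesis unfolding PM_def .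
qed

lemma finite_parts_ge2: "finite (parts_ge2 N)"
  by (rule finite_subset[OF _ finite_partitions[of N]])
    (force simp: parts_ge2_def is_partition_def)

text \<open>A sum \<open>u + v + m\<close> is at least \<open>m\<close>, so it can only hit the new
  element. Summands that reach this element are smaller than it because \<open>m\<close> is
  positive, so only \<open>excess xs\<close> restricts them.\<close>

lemma admissible_Cons:
  assumes "0 < x" "1 \<le> m" and small: "\<forall>t\<in>excess xs. t < m"
  shows "admissible m (x # xs) \<longleftrightarrow>
    (\<forall>u v. u \<notin> excess xs \<longrightarrow> v \<notin> excess xs \<longrightarrow> u + v + m \<noteq> x + length xs - 1)"
    (is "_ \<longleftrightarrow> ?R")
proof
  assume adm: "admissible m (x # xs)"
  show ?R
  proof (intro allI impI notI)
    fix u v assume "u \<notin> excess xs" "v \<notin> excess xs" and eq: "u + v + m = x + length xs - 1"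
    moreover have "u \<noteq> x + length xs - 1" "v \<noteq> x + length xs - 1" using eq \<open>1 \<le> m\<close> by auto
    ultimately have "u + v + m \<notin> excess (x # xs)"
      using adm \<open>0 < x\<close> by (auto simp: admissible_def excess_Cons)
    then show False using eq \<open>0 < x\<close> by (simp add: excess_Cons)
  qed
next
  assume ?R
  then show "admissible m (x # xs)"
    using \<open>0 < x\<close> small by (force simp: admissible_def excess_Cons)
qed


section \<open>Raising the largest part\<close>

fun raise_head :: "nat list \<Rightarrow> nat list" where
  "raise_head [] = []"
| "raise_head (x # xs) = Suc x # xs"

text \<open>The bound \<open>a < j\<close> guarantees at least one trailing \<open>2\<close>. This
  separates the family from \<open>(j, j)\<close>, for which raising does not help once
  \<open>4 \<le> j\<close>.\<close>

definition double_head_twos :: "nat \<Rightarrow> nat list set" where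
  "double_head_twos j = (\<lambda>a. a # a # replicate (j - a) 2) ` {2..<j}"

text \<open>Here the twos may be absent, at \<open>a = j - 1\<close>. The lower bound
  \<open>3\<close> keeps the list nonincreasing.\<close>

definition double_head_three_twos :: "nat \<Rightarrow> nat list set" where
  "double_head_three_twos j = (\<lambda>a. a # a # 3 # replicate (j - 1 - a) 2) ` {3..<j}"

lemma card_double_head_twos: "card (double_head_twos j) = j - 2"
  unfolding double_head_twos_def by (subst card_image) (auto simp: inj_on_def)

lemma card_double_head_three_twos: "card (double_head_three_twos j) = j - 3"
  unfolding double_head_three_twos_def by (subst card_image) (auto simp: inj_on_def)

lemma double_head_twos_subset: "double_head_twos j \<subseteq> parts_ge2 (2 * j)"
  by (auto simp: double_head_twos_def parts_ge2_def sum_list_replicate sorted_wrt_ge_replicate)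

lemma one_mem_excess_replicate_2: "0 < p \<Longrightarrow> 1 \<in> excess (replicate p 2)"
proof (induction p)
  case (Suc p)
  then show ?case by (cases p) (auto simp: excess_Cons)
qed simp

text \<open>If the excess of the tail stays below \<open>j - 1\<close>, both conditions reduce to
  the same equation in \<open>u\<close> and \<open>v\<close>. Otherwise the size estimate is tight
  and determines \<open>\<mu>\<close> up to its largest part.\<close>

lemma admissible_raise_head:
  assumes \<mu>: "\<mu> \<in> parts_ge2 (2 * j)" and j: "4 \<le> j"
  shows "admissible j (raise_head \<mu>) \<longleftrightarrow> admissible (j - 1) \<mu> \<or> \<mu> \<in> double_head_twos j"
    and "\<mu> \<in> double_head_twos j \<Longrightarrow> \<not> admissible (j - 1) \<mu>"
proof -
  obtain x xs where \<mu>_eq: "\<mu> = x # xs"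
    using \<mu> j by (cases \<mu>) (auto simp: parts_ge2_def)
  have sorted: "sorted_wrt (\<ge>) xs" "\<forall>y\<in>set xs. y \<le> x" and ge2: "2 \<le> x" "\<forall>y\<in>set xs. 2 \<le> y"
    and sum: "x + sum_list xs = 2 * j"
    using \<mu> by (auto simp: \<mu>_eq parts_ge2_def)
  \<comment> \<open>With \<open>y\<close> the second part, \<open>2 * (y + length ys)\<close> is at
    most \<open>x + y + sum_list ys = 2 * j\<close>.\<close>
  have bound: "\<forall>t\<in>excess xs. t < j"
  proof (cases xs)
    case (Cons y ys)
    have "2 * length ys \<le> sum_list ys" using ge2 Cons by (intro two_length_le_sum_list) auto
    then have "y + length ys \<le> j" using sorted sum Cons by simp
    moreover have "2 \<le> y" using ge2 Cons by simp
    ultimately show ?thesis using excess_upper_bound[of y ys] sorted ge2 Cons by fastforce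
  qed simp
  have raised: "admissible j (raise_head \<mu>) \<longleftrightarrow>
    (\<forall>u v. u \<notin> excess xs \<longrightarrow> v \<notin> excess xs \<longrightarrow> u + v + j \<noteq> x + length xs)"
    using admissible_Cons[of "Suc x" j xs] bound j by (simp add: \<mu>_eq)
  have "(admissible j (raise_head \<mu>) \<longleftrightarrow> admissible (j - 1) \<mu> \<or> \<mu> \<in> double_head_twos j) \<and>
    (\<mu> \<in> double_head_twos j \<longrightarrow> \<not> admissible (j - 1) \<mu>)"
  proof (cases "\<forall>t\<in>excess xs. t < j - 1")
    case True
    have "admissible (j - 1) \<mu> \<longleftrightarrow>
      (\<forall>u v. u \<notin> excess xs \<longrightarrow> v \<notin> excess xs \<longrightarrow> u + v + (j - 1) \<noteq> x + length xs - 1)"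
      unfolding \<mu>_eq using ge2 j True by (intro admissible_Cons) auto
    also have "\<dots> \<longleftrightarrow> admissible j (raise_head \<mu>)"
    proof -
      have "u + v + (j - 1) = x + length xs - 1 \<longleftrightarrow> u + v + j = x + length xs" for u v
        using ge2 j by auto
      then show ?thesis unfolding raised by simp
    qed
    finally have "admissible (j - 1) \<mu> \<longleftrightarrow> admissible j (raise_head \<mu>)" .
    moreover have "\<mu> \<notin> double_head_twos j"
    proof
      assume "\<mu> \<in> double_head_twos j"
      then obtain a where "2 \<le> a" "a < j" "xs = a # replicate (j - a) 2"
        by (auto simp: double_head_twos_def \<mu>_eq)
      then have "j - 1 \<in> excess xs" by (simp add: excess_Cons)
      with True show False by auto
    qed
    ultimately show ?thesis by simp
  next
    case False
    then obtain y ys where xs: "xs = y # ys" by (cases xs) auto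
    have len: "2 * length ys \<le> sum_list ys" using ge2 xs by (intro two_length_le_sum_list) auto
    from False obtain t where "t \<in> excess xs" "j - 1 \<le> t" by auto
    then have "j - 1 \<le> y + length ys - 1"
      using excess_upper_bound[of y ys t] sorted ge2 xs by simp
    then have "j \<le> y + length ys" using j by simp
    \<comment> \<open>The estimate behind \<open>bound\<close> now holds in both directions, so each
      inequality in it is an equality.\<close>
    with len sorted sum xs have eq: "x = y" "y + length ys = j" "sum_list ys = 2 * length ys"
      by auto
    have ys: "ys = replicate (j - y) 2"
      using sum_list_eq_two_length[of ys] eq ge2 xs by auto
    have "y \<le> j" using eq by simp
    have zero: "0 \<notin> excess \<mu>" "0 \<notin> excess xs"
      using zero_notin_excess ge2 by (auto simp: \<mu>_eq)
    have "j - 1 \<in> excess \<mu>"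
      using ge2 eq j by (simp add: \<mu>_eq xs excess_Cons)
    \<comment> \<open>The choice \<open>u = v = 0\<close> violates the condition.\<close>
    with zero have not_adm: "\<not> admissible (j - 1) \<mu>"
      unfolding admissible_def by (auto intro!: exI[of _ 0])
    have "\<mu> \<in> double_head_twos j \<longleftrightarrow> y < j"
      using ge2 by (auto simp: double_head_twos_def \<mu>_eq xs eq ys)
    moreover have "admissible j (raise_head \<mu>) \<longleftrightarrow> 1 \<in> excess xs"
    proof -
      \<comment> \<open>Here \<open>x + length xs = j + 1\<close>, so \<open>u + v = 1\<close>. As
        \<open>0\<close> is never in the excess, only \<open>1\<close> in the excess can prevent a
        violation.\<close>
      have "u + v + j = x + length xs \<longleftrightarrow> u = 0 \<and> v = 1 \<or> u = 1 \<and> v = 0" for u v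
        using eq xs by auto
      then show ?thesis unfolding raised using zero by metis
    qed
    \<comment> \<open>A trailing \<open>2\<close> contributes \<open>1\<close>. If
      \<open>y = j\<close>, the tail is \<open>[j]\<close>, whose only excess is
      \<open>j - 1\<close>, which differs from \<open>1\<close>.\<close>
    moreover have "1 \<in> excess xs \<longleftrightarrow> y < j"
    proof (cases "y < j")
      case True
      then show ?thesis
        using one_mem_excess_replicate_2[of "j - y"] ge2 by (simp add: xs ys excess_Cons)
    next
      case False
      then show ?thesis using j \<open>y \<le> j\<close> by (simp add: xs ys excess_Cons)
    qed
    ultimately show ?thesis using not_adm by simp
  qed
  then show "admissible j (raise_head \<mu>) \<longleftrightarrow> admissible (j - 1) \<mu> \<or> \<mu> \<in> double_head_twos j"
    and "\<mu> \<in> double_head_twos j \<Longrightarrow> \<not> admissible (j - 1) \<mu>" by auto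
qed

definition equal_heads :: "nat list \<Rightarrow> bool" where
  "equal_heads \<mu> \<longleftrightarrow> length \<mu> \<ge> 2 \<and> \<mu> ! 0 = \<mu> ! 1"

text \<open>Lowering the largest part inverts the raise. It preserves the order because the first
  part strictly exceeds the second, if there is one.\<close>

lemma raise_head_image:
  assumes "4 \<le> j"
  shows "raise_head ` parts_ge2 (2 * j) = {\<mu> \<in> parts_ge2 (2 * j + 1). \<not> equal_heads \<mu>}"
proof (intro equalityI subsetI)
  fix \<nu> assume "\<nu> \<in> raise_head ` parts_ge2 (2 * j)"
  then obtain \<mu> where \<mu>: "\<mu> \<in> parts_ge2 (2 * j)" "\<nu> = raise_head \<mu>" by blast
  then obtain x xs where "\<mu> = x # xs" using assms by (cases \<mu>) (auto simp: parts_ge2_def)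
  with \<mu> show "\<nu> \<in> {\<mu> \<in> parts_ge2 (2 * j + 1). \<not> equal_heads \<mu>}"
    by (cases xs) (auto simp: parts_ge2_def equal_heads_def intro: le_SucI)
next
  fix \<nu> assume \<nu>: "\<nu> \<in> {\<mu> \<in> parts_ge2 (2 * j + 1). \<not> equal_heads \<mu>}"
  then obtain x xs where \<nu>_eq: "\<nu> = x # xs" by (cases \<nu>) (auto simp: parts_ge2_def)
  have "(x - 1) # xs \<in> parts_ge2 (2 * j)"
  proof (cases xs)
    case Nil
    with \<nu> \<nu>_eq assms show ?thesis by (auto simp: parts_ge2_def)
  next
    case (Cons y ys)
    with \<nu> \<nu>_eq have "y < x" "\<forall>z\<in>set ys. z \<le> y" "2 \<le> y"
      by (auto simp: parts_ge2_def equal_heads_def)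
    with \<nu> \<nu>_eq Cons show ?thesis by (force simp: parts_ge2_def)
  qed
  moreover have "\<nu> = raise_head ((x - 1) # xs)"
    using \<nu> by (auto simp: parts_ge2_def \<nu>_eq)
  ultimately show "\<nu> \<in> raise_head ` parts_ge2 (2 * j)" by blast
qed

lemma inj_raise_head: "inj raise_head"
proof (rule injI)
  fix \<mu> \<nu> assume "raise_head \<mu> = raise_head \<nu>"
  then show "\<mu> = \<nu>" by (cases \<mu>; cases \<nu>) auto
qed

text \<open>The first row contributes \<open>x + length ys\<close>, which is at most
  \<open>j\<close>. A violation therefore needs \<open>u = v = 0\<close> and equality, and equality
  forces \<open>ys\<close> to be \<open>3, 2, ..., 2\<close>.\<close>

lemma admissible_equal_heads:
  assumes \<mu>: "\<mu> \<in> parts_ge2 (2 * j + 1)" "equal_heads \<mu>" and j: "4 \<le> j"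
  shows "admissible j \<mu> \<longleftrightarrow> \<mu> \<notin> double_head_three_twos j"
proof -
  obtain x ys where \<mu>_eq: "\<mu> = x # x # ys"
  proof (cases \<mu>)
    case (Cons x xs)
    with \<mu>(2) that show ?thesis by (cases xs) (auto simp: equal_heads_def)
  qed (use \<mu>(2) in \<open>simp add: equal_heads_def\<close>)
  have sorted: "sorted_wrt (\<ge>) (x # ys)" and ge2: "\<forall>y\<in>set (x # ys). 2 \<le> y"
    and sum: "2 * x + sum_list ys = 2 * j + 1"
    using \<mu>(1) by (auto simp: \<mu>_eq parts_ge2_def)
  have len: "2 * length ys \<le> sum_list ys" using ge2 by (intro two_length_le_sum_list) auto
  \<comment> \<open>Parity absorbs the extra unit in \<open>2 * j + 1\<close>.\<close>
  with sum have le: "x + length ys \<le> j" by simp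
  have bound: "\<forall>t\<in>excess (x # ys). t < j"
    using excess_upper_bound[OF sorted ge2] le ge2 by fastforce
  have "0 \<notin> excess (x # ys)" using zero_notin_excess[OF ge2] .
  then have "admissible j \<mu> \<longleftrightarrow> x + length ys \<noteq> j"
    using admissible_Cons[of x j "x # ys"] bound le j ge2
    by (cases "x + length ys = j") (auto simp: \<mu>_eq)
  also have "\<dots> \<longleftrightarrow> \<mu> \<notin> double_head_three_twos j"
  proof -
    have "\<mu> \<in> double_head_three_twos j" if "x + length ys = j"
    proof -
      have "sum_list ys = Suc (2 * length ys)" using that sum by simp
      then have ys: "ys = 3 # replicate (length ys - 1) 2"
        using sorted ge2 by (intro sum_list_eq_two_length_Suc) auto
      then have "3 \<in> set ys" by (metis list.set_intros(1))
      then have "3 \<le> x" "0 < length ys" using sorted by auto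
      moreover have "length ys - 1 = j - 1 - x" using that by simp
      ultimately show ?thesis using ys that
        by (auto simp: double_head_three_twos_def \<mu>_eq intro!: image_eqI[of _ _ x])
    qed
    moreover have "x + length ys = j" if "\<mu> \<in> double_head_three_twos j"
      using that by (auto simp: double_head_three_twos_def \<mu>_eq)
    ultimately show ?thesis by blast
  qed
  finally show ?thesis .
qed

lemma double_head_three_twos_subset:
  "double_head_three_twos j \<subseteq> {\<mu> \<in> parts_ge2 (2 * j + 1). equal_heads \<mu>}"
  by (auto simp: double_head_three_twos_def parts_ge2_def equal_heads_def sum_list_replicate
      sorted_wrt_ge_replicate)

lemma a_bar_eq_card: "a_bar N = card {\<mu> \<in> parts_ge2 N. equal_heads \<mu>}"
proof -
  have "(\<forall>x\<in>set l. 0 < x) \<and> 1 \<notin> set l \<longleftrightarrow> (\<forall>x\<in>set l. 2 \<le> x)" for l :: "nat list"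
    by (induction l) auto
  then have "{l. is_partition l N \<and> length l \<ge> 2 \<and> 1 \<notin> set l \<and> l ! 0 = l ! 1}
    = {\<mu> \<in> parts_ge2 N. equal_heads \<mu>}"
    unfolding is_partition_def parts_ge2_def equal_heads_def by blast
  then show ?thesis by (simp add: a_bar_def)
qed

theorem theorem5p8:
  fixes j :: nat
  assumes "j \<ge> 4"
  shows "int (PM (3 * j) j) - int (PM (3 * j - 2) (j - 1)) = int (a_bar (2 * j + 1)) + 1"
proof -
  let ?A = "{\<mu> \<in> parts_ge2 (2 * j + 1). admissible j \<mu>}"
  let ?B = "{\<mu> \<in> parts_ge2 (2 * j). admissible (j - 1) \<mu>}"
  let ?H = "{\<mu> \<in> parts_ge2 (2 * j + 1). equal_heads \<mu>}"
  have "2 * j + 1 + (j - 1) = 3 * j" "2 * j + (j - 1 - 1) = 3 * j - 2" using assms by auto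
  then have PM: "PM (3 * j) j = card ?A" "PM (3 * j - 2) (j - 1) = card ?B"
    using PM_eq_card_admissible[of j "2 * j + 1"] PM_eq_card_admissible[of "j - 1" "2 * j"] assms
    by simp_all
  \<comment> \<open>The admissible partitions are split by whether the two largest parts agree;
    those where they do not are exactly raised ones.\<close>
  have "?A = (?H - double_head_three_twos j) \<union> raise_head ` (?B \<union> double_head_twos j)"
  proof -
    have "{\<mu> \<in> ?A. equal_heads \<mu>} = ?H - double_head_three_twos j"
      using admissible_equal_heads assms by blast
    moreover have "{\<mu> \<in> ?A. \<not> equal_heads \<mu>}
      = raise_head ` {\<mu> \<in> parts_ge2 (2 * j). admissible j (raise_head \<mu>)}"
    proof -
      have "{\<mu> \<in> ?A. \<not> equal_heads \<mu>} = {\<nu> \<in> raise_head ` parts_ge2 (2 * j). admissible j \<nu>}"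
        unfolding raise_head_image[OF assms] by auto
      then show ?thesis by auto
    qed
    moreover have "{\<mu> \<in> parts_ge2 (2 * j). admissible j (raise_head \<mu>)} = ?B \<union> double_head_twos j"
      using admissible_raise_head(1) double_head_twos_subset assms by blast
    ultimately show ?thesis by blast
  qed
  moreover have "(?H - double_head_three_twos j) \<inter> raise_head ` (?B \<union> double_head_twos j) = {}"
  proof -
    have "raise_head ` (?B \<union> double_head_twos j) \<subseteq> raise_head ` parts_ge2 (2 * j)"
      using double_head_twos_subset by (intro image_mono) auto
    then show ?thesis unfolding raise_head_image[OF assms] by auto
  qed
  moreover have fin: "finite ?H" "finite ?B" "finite (double_head_twos j)"
    by (auto simp: finite_parts_ge2 double_head_twos_def)
  ultimately have "card ?A = card (?H - double_head_three_twos j)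
      + card (raise_head ` (?B \<union> double_head_twos j))"
    by (metis (no_types, lifting) card_Un_disjoint finite_Diff finite_UnI finite_imageI)
  also have "card (raise_head ` (?B \<union> double_head_twos j)) = card (?B \<union> double_head_twos j)"
    using inj_raise_head by (meson card_image inj_on_subset subset_UNIV)
  also have "\<dots> = card ?B + (j - 2)"
  proof -
    have "?B \<inter> double_head_twos j = {}"
      using admissible_raise_head(2) assms by blast
    then show ?thesis using fin by (simp add: card_Un_disjoint card_double_head_twos)
  qed
  also have "card (?H - double_head_three_twos j) = card ?H - (j - 3)"
    using double_head_three_twos_subset fin(1)
    by (metis card_Diff_subset card_double_head_three_twos finite_subset)
  finally have "card ?A = card ?H - (j - 3) + (card ?B + (j - 2))" .
  \<comment> \<open>This makes the truncated subtraction exact. The summand \<open>1\<close> of the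
    theorem is then \<open>(j - 2) - (j - 3)\<close>, the difference in size of the two exceptional
    families.\<close>
  moreover have "j - 3 \<le> card ?H"
    using card_mono[OF fin(1) double_head_three_twos_subset] by (simp add: card_double_head_three_twos)
  ultimately show ?thesis
    using assms unfolding PM a_bar_eq_card by linarith
qed

end
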